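(* Let $d\in\mathbb{N}$, $d\ge 1$, let $\mathcal{T}_h$ be an admissible $d$-dimensional triangulation (a finite set of $d$-dimensional simplices in $\mathbb{R}^d$ with ordered nodes) which is consistently numbered, and let $\tau>0$. Let $$\mathcal{T}_{h,\tau} := \bigcup_{S_d\in\mathcal{T}_h}\mathcal{T}_P(S_d,\tau)$$ be the $(d+1)$-dimensional simplex mesh obtained by decomposing, for every $S_d\in\mathcal{T}_h$, the hyperprism over $S_d$ of height $\tau$ into the $d+1$ simplices of $\mathcal{T}_P(S_d,\tau)$. Then the space-time mesh $\mathcal{T}_{h,\tau}$ is admissible.
   Context: **Simplex.** For affinely independent nodes $p_1,\ldots,p_{m+1}\in\mathbb{R}^k$, the $m$-dimensional simplex is $[p_1,\ldots,p_{m+1}] := \mathrm{conv}(\{p_1,\ldots,p_{m+1}\})$, where the ordering of the nodes is part of the data of the simplex. A face of a simplex is the convex hull of a non-empty subset of its nodes. **Admissible.** A finite set of simplices is called admissible if the intersection of any two of its elements is either empty or a common face of both (a common vertex, edge, triangle, tetrahedron, and so on). **Consistently numbered.** Let $\mathcal{T}_h=\{S_d^i : S_d^i=[p_1^i,\ldots,p_{d+1}^i]\}$ be an admissible $d$-dimensional simplex mesh. It is called consistently numbered iff for any two simplices $S_d^i,S_d^j\in\mathcal{T}_h$ with $S_d^i\cap S_d^j\neq\emptyset$ there exist $n\in\mathbb{N}$, $1\le n\le d+1$, and indices $k_1<\cdots<k_n$ and $\ell_1<\cdots<\ell_n$ in $\{1,\ldots,d+1\}$ such that $$S_d^i\cap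 S_d^j = \mathrm{conv}\{p_{k_1}^i,\ldots,p_{k_n}^i\}\quad\text{and}\quad p_{k_1}^i=p_{\ell_1}^j,\ \ldots,\ p_{k_n}^i=p_{\ell_n}^j .$$ **Hyperprism and its decomposition.** For a simplex $S_d=[p_1,\ldots,p_{d+1}]$ in $\mathbb{R}^d$ and $\tau>0$, put $p_i' := (p_i^\top,0)^\top$ and $p_i'' := (p_i^\top,\tau)^\top$ in $\mathbb{R}^{d+1}$ for $i=1,\ldots,d+1$. The hyperprism over $S_d$ of height $\tau$ is $$P_{d+1} := \mathrm{conv}(\{p_1',\ldots,p_{d+1}',p_1'',\ldots,p_{d+1}''\})\subset\mathbb{R}^{d+1}.$$ For $i=1,\ldots,d+1$ define $$S_{d+1}^i := [p_i',p_{i+1}',\ldots,p_{d+1}',p_1'',p_2'',\ldots,p_i''],$$ and set $\mathcal{T}_P(S_d,\tau) := \{S_{d+1}^1,\ldots,S_{d+1}^{d+1}\}$. *)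

theory Defs
  imports "HOL-Analysis.Analysis"
begin

text \<open>
  The ordering of the nodes belongs to a simplex, so a simplex is represented by the list
  of its nodes; its point set is the convex hull of these. Node indices start at 0.
\<close>

definition ordered_simplex :: "nat \<Rightarrow> 'a::real_vector list \<Rightarrow> bool" where
  "ordered_simplex m S \<longleftrightarrow>
     length S = m + 1 \<and> distinct S \<and> \<not> affine_dependent (set S)"

definition body :: "'a::real_vector list \<Rightarrow> 'a set" where
  "body S = convex hull (set S)"

definition simplex_face :: "'a::real_vector set \<Rightarrow> 'a list \<Rightarrow> bool" where
  "simplex_face F S \<longleftrightarrow> (\<exists>V. V \<noteq> {} \<and> V \<subseteq> set S \<and> F = convex hull V)"

definition simplex_mesh :: "nat \<Rightarrow> 'a::real_vector list set \<Rightarrow> bool" where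
  "simplex_mesh m M \<longleftrightarrow> finite M \<and> (\<forall>S\<in>M. ordered_simplex m S)"

text \<open>
  Only the intersection condition; finiteness of \<open>M\<close> and affine independence of the nodes
  of its elements are part of \<^const>\<open>simplex_mesh\<close>.
\<close>

definition admissible :: "'a::real_vector list set \<Rightarrow> bool" where
  "admissible M \<longleftrightarrow>
     (\<forall>S\<in>M. \<forall>S'\<in>M. body S \<inter> body S' = {} \<or>
        (simplex_face (body S \<inter> body S') S \<and> simplex_face (body S \<inter> body S') S'))"

definition consistently_numbered :: "nat \<Rightarrow> 'a::real_vector list set \<Rightarrow> bool" where
  "consistently_numbered d M \<longleftrightarrow>
     (\<forall>S\<in>M. \<forall>S'\<in>M. body S \<inter> body S' \<noteq> {} \<longrightarrow>
        (\<exists>(n::nat) (k::nat \<Rightarrow> nat) (l::nat \<Rightarrow> nat).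
           1 \<le> n \<and> n \<le> d + 1 \<and>
           strict_mono_on {..<n} k \<and> k ` {..<n} \<subseteq> {..<d + 1} \<and>
           strict_mono_on {..<n} l \<and> l ` {..<n} \<subseteq> {..<d + 1} \<and>
           body S \<inter> body S' = convex hull ((\<lambda>a. S ! k a) ` {..<n}) \<and>
           (\<forall>a<n. S ! k a = S' ! l a)))"

text \<open>
  The space \<open>\<real>\<^sup>d\<^sup>+\<^sup>1\<close> is rendered as the product of \<open>\<real>\<^sup>d\<close> and the time axis \<open>\<real>\<close>.
  With indices from 0, the \<open>i\<close>-th simplex of the decomposed hyperprism over
  \<open>[p\<^sub>0, \<dots>, p\<^sub>d]\<close> is \<open>[(p\<^sub>i, 0), \<dots>, (p\<^sub>d, 0), (p\<^sub>0, \<tau>), \<dots>, (p\<^sub>i, \<tau>)]\<close>.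
\<close>

definition prism_simplex :: "real \<Rightarrow> 'a::real_vector list \<Rightarrow> nat \<Rightarrow> ('a \<times> real) list" where
  "prism_simplex \<tau> S i = map (\<lambda>p. (p, 0)) (drop i S) @ map (\<lambda>p. (p, \<tau>)) (take (Suc i) S)"

definition prism_decomposition :: "'a::real_vector list \<Rightarrow> real \<Rightarrow> ('a \<times> real) list set" where
  "prism_decomposition S \<tau> = prism_simplex \<tau> S ` {..<length S}"

definition spacetime_mesh :: "'a::real_vector list set \<Rightarrow> real \<Rightarrow> ('a \<times> real) list set" where
  "spacetime_mesh M \<tau> = (\<Union>S\<in>M. prism_decomposition S \<tau>)"

end

theory Submission
  imports Defs
begin

text \<open>
  Write the node set of a prism simplex as two layers \<open>A \<times> {0} \<union> B \<times> {\<tau>}\<close>, where \<open>A\<close> consists of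
  the nodes of the spatial simplex \<open>S\<close> from the \<open>i\<close>-th one on and \<open>B\<close> of those up to the \<open>i\<close>-th
  one.  A convex combination of these nodes puts a weight \<open>u\<^sub>0 p\<close> on \<open>(p, 0)\<close> and \<open>u\<^sub>1 p\<close> on
  \<open>(p, \<tau>)\<close>.  The total weight \<open>u\<^sub>0 p + u\<^sub>1 p\<close> is the barycentric coordinate in \<open>S\<close> of the spatial
  part of the point, and \<open>\<Sum>p. u\<^sub>1 p\<close> is its time part divided by \<open>\<tau>\<close>.  As \<open>A\<close> and \<open>B\<close> meet in a
  single node, all weights are determined by these data, which gives affine independence.

  For admissibility let a point lie in two prism simplices, over \<open>S\<close> and \<open>S'\<close>.  Its spatial part
  lies in the common face of \<open>S\<close> and \<open>S'\<close>, so that it has the same barycentric coordinates in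
  both, and they are supported on common nodes.  What could still differ is how each coordinate
  is divided between bottom and top.  But in a prism simplex the weight is lifted to the top
  greedily: all nodes before the \<open>i\<close>-th have their whole weight on the top, all nodes after it have
  it on the bottom, and only the weight of the \<open>i\<close>-th may be split.  Consistent numbering says that
  \<open>S\<close> and \<open>S'\<close> lift the common nodes in the same order, and the time part fixes the total weight to
  be lifted, so the two divisions agree (lemma \<open>layer_weights_unique\<close>).  The point is therefore a
  convex combination of nodes that belong to both prism simplices, and the two simplices meet in the
  convex hull of their common nodes (lemma \<open>convex_hull_two_layers_Int\<close>).
\<close>

section \<open>Uniqueness of weights\<close>

lemma barycentric_coordinates_unique:
  fixes P :: "'a::real_vector set"
  assumes "finite P" and "\<not> affine_dependent P"
    and "sum u P = sum v P" and "(\<Sum>p\<in>P. u p *\<^sub>R p) = (\<Sum>p\<in>P. v p *\<^sub>R p)"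
    and "p \<in> P"
  shows "u p = v p"
proof (rule ccontr)
  assume "u p \<noteq> v p"
  then have "\<exists>q\<in>P. u q - v q \<noteq> 0"
    using \<open>p \<in> P\<close> by force
  moreover have "(\<Sum>q\<in>P. u q - v q) = 0"
    using assms(3) by (simp add: sum_subtractf)
  moreover have "(\<Sum>q\<in>P. (u q - v q) *\<^sub>R q) = 0"
    using assms(4) by (simp add: scaleR_left_diff_distrib sum_subtractf)
  ultimately have "affine_dependent P"
    using affine_dependent_explicit_finite[OF \<open>finite P\<close>] by metis
  with assms(2) show False ..
qed

text \<open>
  An exchange argument.  The hypothesis on pairs \<open>p \<noteq> q\<close> excludes that one division lifts some
  weight of \<open>p\<close> while leaving some of \<open>q\<close> below, and the other one does the opposite; this is all
  that is left of the common lifting order.  If the first division lifted more of \<open>p\<close>, it would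
  hence lift at least as much of every other node, and more in total.
\<close>

lemma lifted_weight_le:
  fixes u\<^sub>0 u\<^sub>1 v\<^sub>0 v\<^sub>1 :: "'b \<Rightarrow> real"
  assumes fin: "finite F"
    and nonneg: "\<And>p. p \<in> F \<Longrightarrow> 0 \<le> u\<^sub>0 p \<and> 0 \<le> u\<^sub>1 p \<and> 0 \<le> v\<^sub>0 p \<and> 0 \<le> v\<^sub>1 p"
    and total: "\<And>p. p \<in> F \<Longrightarrow> u\<^sub>0 p + u\<^sub>1 p = v\<^sub>0 p + v\<^sub>1 p"
    and lifted: "sum u\<^sub>1 F = sum v\<^sub>1 F"
    and no_exchange: "\<And>p q. p \<in> F \<Longrightarrow> q \<in> F \<Longrightarrow> p \<noteq> q \<Longrightarrow>
      u\<^sub>1 p = 0 \<or> u\<^sub>0 q = 0 \<or> v\<^sub>0 p = 0 \<or> v\<^sub>1 q = 0"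
    and "p \<in> F"
  shows "u\<^sub>1 p \<le> v\<^sub>1 p"
proof (rule ccontr)
  assume less: "\<not> u\<^sub>1 p \<le> v\<^sub>1 p"
  then have pos: "u\<^sub>1 p \<noteq> 0" "v\<^sub>0 p \<noteq> 0"
    using nonneg[OF \<open>p \<in> F\<close>] total[OF \<open>p \<in> F\<close>] by linarith+
  have "v\<^sub>1 q \<le> u\<^sub>1 q" if "q \<in> F" for q
  proof (cases "q = p")
    case True
    with less show ?thesis by simp
  next
    case False
    then have "u\<^sub>0 q = 0 \<or> v\<^sub>1 q = 0"
      using no_exchange[OF \<open>p \<in> F\<close> that] pos by auto
    with nonneg[OF that] total[OF that] show ?thesis by linarith
  qed
  moreover have "v\<^sub>1 p < u\<^sub>1 p"
    using less by simp
  ultimately have "sum v\<^sub>1 F < sum u\<^sub>1 F"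
    using fin \<open>p \<in> F\<close> by (intro sum_strict_mono_ex1) auto
  with lifted show False by simp
qed

lemma layer_weights_unique:
  fixes u\<^sub>0 u\<^sub>1 v\<^sub>0 v\<^sub>1 :: "'b \<Rightarrow> real"
  assumes "finite F"
    and nonneg: "\<And>p. p \<in> F \<Longrightarrow> 0 \<le> u\<^sub>0 p \<and> 0 \<le> u\<^sub>1 p \<and> 0 \<le> v\<^sub>0 p \<and> 0 \<le> v\<^sub>1 p"
    and total: "\<And>p. p \<in> F \<Longrightarrow> u\<^sub>0 p + u\<^sub>1 p = v\<^sub>0 p + v\<^sub>1 p"
    and lifted: "sum u\<^sub>1 F = sum v\<^sub>1 F"
    and no_exchange: "\<And>p q. p \<in> F \<Longrightarrow> q \<in> F \<Longrightarrow> p \<noteq> q \<Longrightarrow>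
      u\<^sub>1 p = 0 \<or> u\<^sub>0 q = 0 \<or> v\<^sub>0 p = 0 \<or> v\<^sub>1 q = 0"
    and "p \<in> F"
  shows "u\<^sub>0 p = v\<^sub>0 p \<and> u\<^sub>1 p = v\<^sub>1 p"
proof -
  have "u\<^sub>1 p \<le> v\<^sub>1 p"
    using assms by (rule lifted_weight_le)
  moreover have "v\<^sub>1 p \<le> u\<^sub>1 p"
  proof (rule lifted_weight_le[OF \<open>finite F\<close> _ _ _ _ \<open>p \<in> F\<close>])
    \<comment> \<open>The exclusion of exchanges is symmetric in the two divisions if \<open>p\<close> and \<open>q\<close> are swapped too.\<close>
    show "v\<^sub>1 p = 0 \<or> v\<^sub>0 q = 0 \<or> u\<^sub>0 p = 0 \<or> u\<^sub>1 q = 0" if "p \<in> F" "q \<in> F" "p \<noteq> q" for p q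
      using no_exchange[of q p] that by auto
  qed (use nonneg total lifted in auto)
  ultimately show ?thesis
    using total[OF \<open>p \<in> F\<close>] by simp
qed

section \<open>Point sets in two layers\<close>

definition two_layers :: "real \<Rightarrow> 'a set \<Rightarrow> 'a set \<Rightarrow> ('a \<times> real) set" where
  "two_layers \<tau> A B = A \<times> {0} \<union> B \<times> {\<tau>}"

lemma two_layers_Int:
  "\<tau> \<noteq> 0 \<Longrightarrow> two_layers \<tau> A B \<inter> two_layers \<tau> A' B' = two_layers \<tau> (A \<inter> A') (B \<inter> B')"
  by (auto simp: two_layers_def)

lemma finite_two_layers: "finite A \<Longrightarrow> finite B \<Longrightarrow> finite (two_layers \<tau> A B)"
  by (simp add: two_layers_def)

text \<open>
  Extending the weights of both layers by zero to a common set \<open>P\<close> makes it possible to add them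
  node by node.
\<close>

lemma sum_two_layers:
  fixes g :: "'a \<times> real \<Rightarrow> 'b::comm_monoid_add"
  assumes "finite P" "A \<subseteq> P" "B \<subseteq> P" "\<tau> \<noteq> 0"
  shows "sum g (two_layers \<tau> A B) =
    (\<Sum>p\<in>P. (if p \<in> A then g (p, 0) else 0) + (if p \<in> B then g (p, \<tau>) else 0))"
proof -
  have fin: "finite A" "finite B"
    using assms finite_subset by auto
  have layer: "sum g (C \<times> {c}) = (\<Sum>p\<in>P. if p \<in> C then g (p, c) else 0)" if "C \<subseteq> P" for C c
  proof -
    have "sum g (C \<times> {c}) = (\<Sum>p\<in>C. g (p, c))"
      by (rule sum.reindex_bij_witness[of _ "\<lambda>p. (p, c)" fst]) auto
    also have "\<dots> = (\<Sum>p\<in>P \<inter> C. g (p, c))"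
      using that by (simp add: Int_absorb1)
    also have "\<dots> = (\<Sum>p\<in>P. if p \<in> C then g (p, c) else 0)"
      by (rule sum.inter_restrict[OF \<open>finite P\<close>])
    finally show ?thesis .
  qed
  have "sum g (two_layers \<tau> A B) = sum g (A \<times> {0}) + sum g (B \<times> {\<tau>})"
    unfolding two_layers_def using fin \<open>\<tau> \<noteq> 0\<close> by (intro sum.union_disjoint) auto
  then show ?thesis
    by (simp only: layer[OF \<open>A \<subseteq> P\<close>] layer[OF \<open>B \<subseteq> P\<close>] sum.distrib)
qed

lemma sum_two_layers_weighted:
  fixes w :: "'a::real_vector \<times> real \<Rightarrow> real"
  assumes P: "finite P" "A \<subseteq> P" "B \<subseteq> P" "\<tau> \<noteq> 0"
    and u\<^sub>0: "\<And>p. u\<^sub>0 p = (if p \<in> A then w (p, 0) else 0)"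
    and u\<^sub>1: "\<And>p. u\<^sub>1 p = (if p \<in> B then w (p, \<tau>) else 0)"
  shows "sum w (two_layers \<tau> A B) = (\<Sum>p\<in>P. u\<^sub>0 p + u\<^sub>1 p)"
    and "(\<Sum>z\<in>two_layers \<tau> A B. w z *\<^sub>R z) =
      ((\<Sum>p\<in>P. (u\<^sub>0 p + u\<^sub>1 p) *\<^sub>R p), \<tau> * sum u\<^sub>1 P)"
proof -
  show "sum w (two_layers \<tau> A B) = (\<Sum>p\<in>P. u\<^sub>0 p + u\<^sub>1 p)"
    by (simp add: sum_two_layers[OF P] u\<^sub>0 u\<^sub>1)
  have "(\<Sum>z\<in>two_layers \<tau> A B. w z *\<^sub>R z) =
      (\<Sum>p\<in>P. ((u\<^sub>0 p + u\<^sub>1 p) *\<^sub>R p, \<tau> * u\<^sub>1 p))"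
    unfolding sum_two_layers[OF P]
    by (intro sum.cong) (auto simp: u\<^sub>0 u\<^sub>1 scaleR_left_distrib zero_prod_def mult.commute)
  then show "(\<Sum>z\<in>two_layers \<tau> A B. w z *\<^sub>R z) =
      ((\<Sum>p\<in>P. (u\<^sub>0 p + u\<^sub>1 p) *\<^sub>R p), \<tau> * sum u\<^sub>1 P)"
    by (simp add: sum_prod sum_distrib_left)
qed

lemma mem_convex_hull_two_layers_iff:
  fixes P :: "'a::real_vector set"
  assumes P: "finite P" "A \<subseteq> P" "B \<subseteq> P" "\<tau> \<noteq> 0"
  shows "(x, t) \<in> convex hull two_layers \<tau> A B \<longleftrightarrow>
    (\<exists>u\<^sub>0 u\<^sub>1. (\<forall>p. 0 \<le> u\<^sub>0 p \<and> 0 \<le> u\<^sub>1 p) \<and> (\<forall>p. p \<notin> A \<longrightarrow> u\<^sub>0 p = 0) \<and> (\<forall>p. p \<notin> B \<longrightarrow> u\<^sub>1 p = 0) \<and>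
      (\<Sum>p\<in>P. u\<^sub>0 p + u\<^sub>1 p) = 1 \<and> (\<Sum>p\<in>P. (u\<^sub>0 p + u\<^sub>1 p) *\<^sub>R p) = x \<and> \<tau> * sum u\<^sub>1 P = t)"
    (is "?L \<longleftrightarrow> ?R")
proof -
  have fin: "finite (two_layers \<tau> A B)"
    using P finite_subset by (intro finite_two_layers) auto
  show ?thesis
  proof
    assume ?L
    then obtain w where w: "\<And>z. z \<in> two_layers \<tau> A B \<Longrightarrow> 0 \<le> w z" "sum w (two_layers \<tau> A B) = 1"
        "(\<Sum>z\<in>two_layers \<tau> A B. w z *\<^sub>R z) = (x, t)"
      by (auto simp: convex_hull_finite[OF fin])
    define u\<^sub>0 where "u\<^sub>0 p = (if p \<in> A then w (p, 0) else 0)" for p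
    define u\<^sub>1 where "u\<^sub>1 p = (if p \<in> B then w (p, \<tau>) else 0)" for p
    note sums = sum_two_layers_weighted[OF P u\<^sub>0_def u\<^sub>1_def]
    have "\<forall>p. 0 \<le> u\<^sub>0 p \<and> 0 \<le> u\<^sub>1 p"
      using w(1) by (auto simp: u\<^sub>0_def u\<^sub>1_def two_layers_def)
    moreover have "(\<Sum>p\<in>P. u\<^sub>0 p + u\<^sub>1 p) = 1"
      using w(2) sums(1) by simp
    moreover have "(\<Sum>p\<in>P. (u\<^sub>0 p + u\<^sub>1 p) *\<^sub>R p) = x" "\<tau> * sum u\<^sub>1 P = t"
      using w(3) sums(2) by simp_all
    ultimately show ?R
      by (intro exI[of _ u\<^sub>0] exI[of _ u\<^sub>1]) (simp add: u\<^sub>0_def u\<^sub>1_def)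
  next
    assume ?R
    then obtain u\<^sub>0 u\<^sub>1 where u: "\<And>p. 0 \<le> u\<^sub>0 p" "\<And>p. 0 \<le> u\<^sub>1 p" "\<And>p. p \<notin> A \<Longrightarrow> u\<^sub>0 p = 0"
        "\<And>p. p \<notin> B \<Longrightarrow> u\<^sub>1 p = 0" "(\<Sum>p\<in>P. u\<^sub>0 p + u\<^sub>1 p) = 1"
        "(\<Sum>p\<in>P. (u\<^sub>0 p + u\<^sub>1 p) *\<^sub>R p) = x" "\<tau> * sum u\<^sub>1 P = t"
      by blast
    define w where "w z = (if snd z = 0 then u\<^sub>0 (fst z) else u\<^sub>1 (fst z))" for z :: "'a \<times> real"
    have "u\<^sub>0 p = (if p \<in> A then w (p, 0) else 0)" "u\<^sub>1 p = (if p \<in> B then w (p, \<tau>) else 0)" for p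
      using u(3,4) \<open>\<tau> \<noteq> 0\<close> by (auto simp: w_def)
    note sums = sum_two_layers_weighted[OF P this]
    have "\<forall>z\<in>two_layers \<tau> A B. 0 \<le> w z"
      using u(1,2) by (simp add: w_def)
    then show ?L
      unfolding convex_hull_finite[OF fin] using sums u(5-7) by auto
  qed
qed

lemma affine_independent_two_layers:
  fixes P :: "'a::real_vector set"
  assumes P: "finite P" "A \<subseteq> P" "B \<subseteq> P" "\<tau> \<noteq> 0"
    and indep: "\<not> affine_dependent P" and meet: "A \<inter> B \<subseteq> {c}"
  shows "\<not> affine_dependent (two_layers \<tau> A B)"
proof
  have fin: "finite (two_layers \<tau> A B)"
    using P finite_subset by (intro finite_two_layers) auto
  assume "affine_dependent (two_layers \<tau> A B)"
  then obtain w where w: "sum w (two_layers \<tau> A B) = 0" "\<exists>z\<in>two_layers \<tau> A B. w z \<noteq> 0"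
      "(\<Sum>z\<in>two_layers \<tau> A B. w z *\<^sub>R z) = 0"
    unfolding affine_dependent_explicit_finite[OF fin] by blast
  define u\<^sub>0 where "u\<^sub>0 p = (if p \<in> A then w (p, 0) else 0)" for p
  define u\<^sub>1 where "u\<^sub>1 p = (if p \<in> B then w (p, \<tau>) else 0)" for p
  note sums = sum_two_layers_weighted[OF P u\<^sub>0_def u\<^sub>1_def]
  have "u\<^sub>0 p + u\<^sub>1 p = 0" if "p \<in> P" for p
    using barycentric_coordinates_unique[OF \<open>finite P\<close> indep, of "\<lambda>p. u\<^sub>0 p + u\<^sub>1 p" "\<lambda>_. 0" p]
      w(1,3) sums that by (simp add: zero_prod_def)
  then have opposite: "u\<^sub>0 p = - u\<^sub>1 p" for p
    using P(2,3) by (cases "p \<in> P") (auto simp: u\<^sub>0_def u\<^sub>1_def add_eq_0_iff)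
  \<comment> \<open>Opposite weights on the two layers vanish except over \<open>c\<close>, and there the time part decides.\<close>
  then have off: "u\<^sub>1 p = 0" if "p \<noteq> c" for p
    using meet that opposite[of p] by (cases "p \<in> A") (auto simp: u\<^sub>0_def u\<^sub>1_def)
  have "sum u\<^sub>1 P = 0"
    using w(3) sums(2) \<open>\<tau> \<noteq> 0\<close> by (simp add: zero_prod_def)
  moreover have "sum u\<^sub>1 P = (\<Sum>p\<in>P. if p = c then u\<^sub>1 c else 0)"
    using off by (intro sum.cong) auto
  ultimately have "u\<^sub>1 c = 0 \<or> c \<notin> P"
    using \<open>finite P\<close> by (auto simp: sum.delta split: if_splits)
  then have "u\<^sub>1 p = 0" for p
    using off P(3) by (cases "p = c") (auto simp: u\<^sub>1_def)
  with opposite have "w z = 0" if "z \<in> two_layers \<tau> A B" for z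
    using that by (auto simp: two_layers_def u\<^sub>0_def u\<^sub>1_def split: if_splits)
      (metis minus_zero)+
  with w(2) show False by blast
qed

text \<open>
  A point of \<open>conv F\<close> has its barycentric coordinates with respect to any affinely independent
  superset \<open>P\<close> concentrated on \<open>F\<close>, where they do not depend on \<open>P\<close>.  This reduces the weights in
  the two sets to the setting of \<open>layer_weights_unique\<close>.
\<close>

lemma convex_hull_two_layers_Int:
  fixes P P' :: "'a::real_vector set"
  assumes P: "finite P" "A \<subseteq> P" "B \<subseteq> P" "\<not> affine_dependent P"
    and P': "finite P'" "A' \<subseteq> P'" "B' \<subseteq> P'" "\<not> affine_dependent P'"
    and "\<tau> \<noteq> 0"
    and F: "F \<subseteq> P" "F \<subseteq> P'" "convex hull P \<inter> convex hull P' \<subseteq> convex hull F"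
    and order: "\<And>p q. p \<in> F \<Longrightarrow> q \<in> F \<Longrightarrow> p \<in> B \<Longrightarrow> q \<in> A \<Longrightarrow> p \<in> A' \<Longrightarrow> q \<in> B' \<Longrightarrow> p = q"
  shows "convex hull two_layers \<tau> A B \<inter> convex hull two_layers \<tau> A' B' =
    convex hull (two_layers \<tau> A B \<inter> two_layers \<tau> A' B')"
proof
  show "convex hull (two_layers \<tau> A B \<inter> two_layers \<tau> A' B') \<subseteq>
      convex hull two_layers \<tau> A B \<inter> convex hull two_layers \<tau> A' B'"
    by (simp add: hull_mono)
  show "convex hull two_layers \<tau> A B \<inter> convex hull two_layers \<tau> A' B' \<subseteq>
      convex hull (two_layers \<tau> A B \<inter> two_layers \<tau> A' B')"
  proof clarify
    fix x t
    assume in_L: "(x, t) \<in> convex hull two_layers \<tau> A B"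
      and in_L': "(x, t) \<in> convex hull two_layers \<tau> A' B'"
    from in_L obtain u\<^sub>0 u\<^sub>1 where u: "\<And>p. 0 \<le> u\<^sub>0 p" "\<And>p. 0 \<le> u\<^sub>1 p" "\<And>p. p \<notin> A \<Longrightarrow> u\<^sub>0 p = 0"
        "\<And>p. p \<notin> B \<Longrightarrow> u\<^sub>1 p = 0" "(\<Sum>p\<in>P. u\<^sub>0 p + u\<^sub>1 p) = 1"
        "(\<Sum>p\<in>P. (u\<^sub>0 p + u\<^sub>1 p) *\<^sub>R p) = x" "\<tau> * sum u\<^sub>1 P = t"
      unfolding mem_convex_hull_two_layers_iff[OF P(1-3) \<open>\<tau> \<noteq> 0\<close>] by blast
    from in_L' obtain v\<^sub>0 v\<^sub>1 where v: "\<And>p. 0 \<le> v\<^sub>0 p" "\<And>p. 0 \<le> v\<^sub>1 p" "\<And>p. p \<notin> A' \<Longrightarrow> v\<^sub>0 p = 0"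
        "\<And>p. p \<notin> B' \<Longrightarrow> v\<^sub>1 p = 0" "(\<Sum>p\<in>P'. v\<^sub>0 p + v\<^sub>1 p) = 1"
        "(\<Sum>p\<in>P'. (v\<^sub>0 p + v\<^sub>1 p) *\<^sub>R p) = x" "\<tau> * sum v\<^sub>1 P' = t"
      unfolding mem_convex_hull_two_layers_iff[OF P'(1-3) \<open>\<tau> \<noteq> 0\<close>] by blast
    have "x \<in> convex hull P"
      unfolding convex_hull_finite[OF P(1)] using u
      by (intro CollectI exI[of _ "\<lambda>p. u\<^sub>0 p + u\<^sub>1 p"]) auto
    moreover have "x \<in> convex hull P'"
      unfolding convex_hull_finite[OF P'(1)] using v
      by (intro CollectI exI[of _ "\<lambda>p. v\<^sub>0 p + v\<^sub>1 p"]) auto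
    ultimately have "x \<in> convex hull F"
      using F(3) by blast
    have finF: "finite F"
      using F(1) P(1) finite_subset by blast
    from \<open>x \<in> convex hull F\<close> obtain m where m: "sum m F = 1" "(\<Sum>p\<in>F. m p *\<^sub>R p) = x"
      unfolding convex_hull_finite[OF finF] by auto
    have coordinates: "c p = (if p \<in> F then m p else 0)"
      if Q: "finite Q" "\<not> affine_dependent Q" "F \<subseteq> Q"
        and c: "sum c Q = 1" "(\<Sum>p\<in>Q. c p *\<^sub>R p) = x" and "p \<in> Q" for c Q p
    proof (rule barycentric_coordinates_unique[OF Q(1,2) _ _ \<open>p \<in> Q\<close>])
      have "(\<Sum>p\<in>Q. if p \<in> F then m p else 0) = sum m F"
        using Q by (simp add: sum.inter_restrict[symmetric] Int_absorb1)
      with c m show "sum c Q = (\<Sum>p\<in>Q. if p \<in> F then m p else 0)" by simp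
      have "(\<Sum>p\<in>Q. (if p \<in> F then m p else 0) *\<^sub>R p) = (\<Sum>p\<in>Q. if p \<in> F then m p *\<^sub>R p else 0)"
        by (intro sum.cong) auto
      also have "\<dots> = (\<Sum>p\<in>F. m p *\<^sub>R p)"
        using Q by (simp add: sum.inter_restrict[symmetric] Int_absorb1)
      finally show "(\<Sum>p\<in>Q. c p *\<^sub>R p) = (\<Sum>p\<in>Q. (if p \<in> F then m p else 0) *\<^sub>R p)"
        using c m by simp
    qed
    have u_total: "u\<^sub>0 p + u\<^sub>1 p = (if p \<in> F then m p else 0)" if "p \<in> P" for p
      by (rule coordinates[OF P(1,4) F(1) u(5,6) that])
    have v_total: "v\<^sub>0 p + v\<^sub>1 p = (if p \<in> F then m p else 0)" if "p \<in> P'" for p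
      by (rule coordinates[OF P'(1,4) F(2) v(5,6) that])
    have u_off: "u\<^sub>0 p = 0 \<and> u\<^sub>1 p = 0" if "p \<in> P - F" for p
      using u_total[of p] u(1,2)[of p] that by (auto simp: add_nonneg_eq_0_iff)
    have v_off: "v\<^sub>0 p = 0 \<and> v\<^sub>1 p = 0" if "p \<in> P' - F" for p
      using v_total[of p] v(1,2)[of p] that by (auto simp: add_nonneg_eq_0_iff)
    have lifted_u: "sum u\<^sub>1 P = sum u\<^sub>1 F"
      using P(1) F(1) u_off by (intro sum.mono_neutral_right) auto
    have lifted_v: "sum v\<^sub>1 P' = sum v\<^sub>1 F"
      using P'(1) F(2) v_off by (intro sum.mono_neutral_right) auto
    have same: "u\<^sub>0 p = v\<^sub>0 p \<and> u\<^sub>1 p = v\<^sub>1 p" if "p \<in> F" for p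
    proof (rule layer_weights_unique[OF finF _ _ _ _ that])
      show "u\<^sub>0 p + u\<^sub>1 p = v\<^sub>0 p + v\<^sub>1 p" if "p \<in> F" for p
        using u_total v_total that F(1,2) by (metis subsetD)
      show "sum u\<^sub>1 F = sum v\<^sub>1 F"
        using u(7) v(7) lifted_u lifted_v \<open>\<tau> \<noteq> 0\<close> by (metis mult_left_cancel)
      show "u\<^sub>1 p = 0 \<or> u\<^sub>0 q = 0 \<or> v\<^sub>0 p = 0 \<or> v\<^sub>1 q = 0" if "p \<in> F" "q \<in> F" "p \<noteq> q" for p q
        using order[of p q] that u(3,4) v(3,4) by blast
    qed (use u v in auto)
    have supp: "u\<^sub>0 p = 0" if "p \<notin> A \<inter> A'" for p
      using that u(3) v(3) u_off same P(2) by (metis DiffI IntI subsetD)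
    have supp': "u\<^sub>1 p = 0" if "p \<notin> B \<inter> B'" for p
      using that u(4) v(4) u_off same P(3) by (metis DiffI IntI subsetD)
    have sub: "A \<inter> A' \<subseteq> P" "B \<inter> B' \<subseteq> P"
      using P(2,3) by auto
    show "(x, t) \<in> convex hull (two_layers \<tau> A B \<inter> two_layers \<tau> A' B')"
      unfolding two_layers_Int[OF \<open>\<tau> \<noteq> 0\<close>] mem_convex_hull_two_layers_iff[OF P(1) sub \<open>\<tau> \<noteq> 0\<close>]
      using u supp supp' by blast
  qed
qed

section \<open>Decomposed hyperprisms\<close>

lemma set_prism_simplex:
  "set (prism_simplex \<tau> S i) = two_layers \<tau> (set (drop i S)) (set (take (Suc i) S))"
  by (auto simp: prism_simplex_def two_layers_def)

lemma nth_mem_drop_iff: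
  "distinct S \<Longrightarrow> a < length S \<Longrightarrow> S ! a \<in> set (drop i S) \<longleftrightarrow> i \<le> a"
  by (auto simp: in_set_conv_nth nth_eq_iff_index_eq intro: exI[of _ "a - i"])

lemma nth_mem_take_iff:
  "distinct S \<Longrightarrow> a < length S \<Longrightarrow> S ! a \<in> set (take i S) \<longleftrightarrow> a < i"
  by (auto simp: in_set_conv_nth nth_eq_iff_index_eq)

lemma ordered_simplex_prism_simplex:
  assumes S: "ordered_simplex d S" and i: "i < length S" and "\<tau> \<noteq> 0"
  shows "ordered_simplex (d + 1) (prism_simplex \<tau> S i)"
proof -
  have S': "length S = d + 1" "distinct S" "\<not> affine_dependent (set S)"
    using S by (auto simp: ordered_simplex_def)
  have "distinct (prism_simplex \<tau> S i)"
    using S'(2) \<open>\<tau> \<noteq> 0\<close> by (auto simp: prism_simplex_def distinct_map inj_on_def)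
  moreover have "length (prism_simplex \<tau> S i) = d + 1 + 1"
    using i S'(1) by (simp add: prism_simplex_def)
  moreover have "set (drop i S) \<inter> set (take (Suc i) S) \<subseteq> {S ! i}"
  proof
    fix p
    assume p: "p \<in> set (drop i S) \<inter> set (take (Suc i) S)"
    then obtain a where "a < length S" "p = S ! a"
      by (metis IntD1 in_set_conv_nth in_set_dropD)
    moreover from this p S'(2) have "a = i"
      by (simp add: nth_mem_drop_iff nth_mem_take_iff)
    ultimately show "p \<in> {S ! i}"
      by simp
  qed
  then have "\<not> affine_dependent (set (prism_simplex \<tau> S i))"
    unfolding set_prism_simplex using S'(3) \<open>\<tau> \<noteq> 0\<close>
    by (intro affine_independent_two_layers[of "set S"]) (auto dest: in_set_dropD in_set_takeD)
  ultimately show ?thesis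
    by (simp add: ordered_simplex_def)
qed

lemma simplex_mesh_spacetime_mesh:
  assumes "simplex_mesh d T" and "\<tau> \<noteq> 0"
  shows "simplex_mesh (d + 1) (spacetime_mesh T \<tau>)"
  using assms ordered_simplex_prism_simplex
  by (fastforce simp: simplex_mesh_def spacetime_mesh_def prism_decomposition_def)

text \<open>
  The nodes of the common face, which consistent numbering lists in the order of both simplices,
  serve as \<open>F\<close> in \<open>convex_hull_two_layers_Int\<close>.
\<close>

lemma body_prism_simplex_Int:
  fixes T :: "'a::real_vector list set"
  assumes "simplex_mesh d T" and "consistently_numbered d T" and "\<tau> \<noteq> 0"
    and "S \<in> T" "S' \<in> T"
    and meet: "body (prism_simplex \<tau> S i) \<inter> body (prism_simplex \<tau> S' j) \<noteq> {}"
  shows "body (prism_simplex \<tau> S i) \<inter> body (prism_simplex \<tau> S' j) =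
    convex hull (set (prism_simplex \<tau> S i) \<inter> set (prism_simplex \<tau> S' j))"
proof -
  have S: "length S = d + 1" "distinct S" "\<not> affine_dependent (set S)"
    and S': "length S' = d + 1" "distinct S'" "\<not> affine_dependent (set S')"
    using assms by (auto simp: simplex_mesh_def ordered_simplex_def)
  have "fst ` body (prism_simplex \<tau> Q i) \<subseteq> body Q" for Q :: "'a list" and i
  proof -
    have "fst ` body (prism_simplex \<tau> Q i) = convex hull (fst ` set (prism_simplex \<tau> Q i))"
      unfolding body_def by (rule convex_hull_linear_image[OF linear_fst])
    also have "\<dots> \<subseteq> body Q"
      unfolding body_def
      by (rule hull_mono) (auto simp: prism_simplex_def dest: in_set_dropD in_set_takeD)
    finally show ?thesis .
  qed
  with meet have "body S \<inter> body S' \<noteq> {}"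
    by fast
  note numbering = assms(2)[unfolded consistently_numbered_def, rule_format,
      OF \<open>S \<in> T\<close> \<open>S' \<in> T\<close> this]
  then obtain n :: nat and k l :: "nat \<Rightarrow> nat" where
      k: "strict_mono_on {..<n} k" "k ` {..<n} \<subseteq> {..<d + 1}" and
      l: "strict_mono_on {..<n} l" "l ` {..<n} \<subseteq> {..<d + 1}" and
      face: "body S \<inter> body S' = convex hull ((\<lambda>a. S ! k a) ` {..<n})" and
      common: "\<forall>a<n. S ! k a = S' ! l a"
    by (elim exE conjE) (rule that)
  let ?F = "(\<lambda>a. S ! k a) ` {..<n}"
  have order: "p = q"
    if pq: "p \<in> ?F" "q \<in> ?F" and mem: "p \<in> set (take (Suc i) S)" "q \<in> set (drop i S)"
      "p \<in> set (drop j S')" "q \<in> set (take (Suc j) S')" for p q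
  proof -
    obtain a b where ab: "a < n" "b < n" "p = S ! k a" "q = S ! k b"
      using pq by auto
    then have ab': "p = S' ! l a" "q = S' ! l b"
      using common by auto
    have bounds: "k a < length S" "k b < length S" "l a < length S'" "l b < length S'"
      using ab(1,2) k(2) l(2) S(1) S'(1) by auto
    \<comment> \<open>The two simplices are cut at \<open>i\<close> and \<open>j\<close>: in \<open>S\<close> the node \<open>p\<close> does not come after \<open>q\<close>, and in
      \<open>S'\<close> it does not come before \<open>q\<close>.\<close>
    have "k a \<le> i" "i \<le> k b"
      using mem(1,2) S(2) bounds by (simp_all add: ab nth_mem_drop_iff nth_mem_take_iff)
    then have "a \<le> b"
      using k(1) ab(1,2) by (meson lessThan_iff le_trans not_le strict_mono_onD)
    have "l b \<le> j" "j \<le> l a"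
      using mem(3,4) S'(2) bounds by (simp_all add: ab' nth_mem_drop_iff nth_mem_take_iff)
    then have "b \<le> a"
      using l(1) ab(1,2) by (meson lessThan_iff le_trans not_le strict_mono_onD)
    with \<open>a \<le> b\<close> ab show "p = q" by simp
  qed
  have "S ! k a \<in> set S" "S' ! l a \<in> set S'" if "a < n" for a
    using k(2) l(2) S(1) S'(1) that by (auto simp: image_subset_iff)
  then have sub: "?F \<subseteq> set S" "?F \<subseteq> set S'"
    using common by auto
  show ?thesis
    unfolding body_def set_prism_simplex
  proof (rule convex_hull_two_layers_Int[OF finite_set _ _ S(3) finite_set _ _ S'(3) \<open>\<tau> \<noteq> 0\<close> sub])
    show "convex hull set S \<inter> convex hull set S' \<subseteq> convex hull ?F"
      using face by (simp add: body_def)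
  qed (assumption | rule set_drop_subset set_take_subset order)+
qed

lemma admissible_spacetime_mesh:
  assumes "simplex_mesh d T" and "consistently_numbered d T" and "\<tau> \<noteq> 0"
  shows "admissible (spacetime_mesh T \<tau>)"
  unfolding admissible_def disj_imp
proof (intro ballI impI)
  fix R R'
  assume "R \<in> spacetime_mesh T \<tau>" "R' \<in> spacetime_mesh T \<tau>" and meet: "body R \<inter> body R' \<noteq> {}"
  then obtain S S' i j where "S \<in> T" "S' \<in> T"
      "R = prism_simplex \<tau> S i" "R' = prism_simplex \<tau> S' j"
    unfolding spacetime_mesh_def prism_decomposition_def by blast
  with meet have eq: "body R \<inter> body R' = convex hull (set R \<inter> set R')"
    using body_prism_simplex_Int[OF assms] by simp
  with meet have "set R \<inter> set R' \<noteq> {}"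
    by auto
  then show "simplex_face (body R \<inter> body R') R \<and> simplex_face (body R \<inter> body R') R'"
    unfolding simplex_face_def eq by (intro conjI exI[of _ "set R \<inter> set R'"]) simp_all
qed

theorem theorem1:
  fixes T :: "(real ^ 'n) list set" and \<tau> :: real
  assumes "simplex_mesh CARD('n) T"
    and "admissible T"
    and "consistently_numbered CARD('n) T"
    and "\<tau> > 0"
  shows "simplex_mesh (CARD('n) + 1) (spacetime_mesh T \<tau>) \<and> admissible (spacetime_mesh T \<tau>)"
  using assms simplex_mesh_spacetime_mesh admissible_spacetime_mesh by (metis less_irrefl)

end
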